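(* Let $n\ge1$, let $U_n$ be Haar distributed on $U(n)$, and let $\xi_n$, $E_n$ and $\log\xi_n$ be as in the context. Let $f$ be an integrable $\mathcal{C}^1$ function from $\mathbb{R}$ to $\mathbb{R}$ such that $$|xf(x)|\underset{|x|\to\infty}{\longrightarrow}0,\qquad\int_{\mathbb{R}}|xf'(x)|\,dx<\infty.$$ Then almost surely $$\sum_{x\in E_n}f(x)-\int_{\mathbb{R}}f(x)\,dx=\frac1\pi\int_{-\infty}^{\infty}\Im\log(\xi_n(y))f'(y)\,dy.$$
   Context: $Z_n(X)=\det(\mathrm{Id}-U_n^{-1}X)$ and $\xi_n(z)=Z_n(e^{2i\pi z/n})/Z_n(1)$, an entire function whose zero set is $E_n=\{\frac{n}{2\pi}\theta:\theta\in\mathbb{R},\ e^{i\theta}\text{ an eigenvalue of }U_n\}$; almost surely $0\notin E_n$. $\log\xi_n$ is the unique determination of the logarithm of $\xi_n$ vanishing at $0$ and continuous on $\mathbb{C}\setminus\{y-iu: y\in E_n, u\ge0\}$ (so $\log\xi_n(y)$ is defined for all real $y\notin E_n$). *)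

theory Defs
  imports "HOL-Probability.Probability"
begin

definition conj_transpose :: "complex^'n^'m \<Rightarrow> complex^'m^'n"
  where "conj_transpose A = (\<chi> i j. cnj (A $ j $ i))"

definition unitary_group :: "(complex^'n^'n) set"
  where "unitary_group = {A. conj_transpose A ** A = mat 1 \<and> A ** conj_transpose A = mat 1}"

abbreviation borel_unitary :: "(complex^'n^'n) measure"
  where "borel_unitary \<equiv> restrict_space borel unitary_group"

(* Left invariance suffices: the unitary group is compact, so its unique left-invariant Borel
   probability measure is also right-invariant. *)
definition haar_unitary :: "(complex^'n^'n) measure \<Rightarrow> bool"
  where "haar_unitary M \<longleftrightarrow>
    prob_space M \<and> sets M = sets borel_unitary \<and>
    (\<forall>V\<in>unitary_group. distr M M (\<lambda>X. V ** X) = M)"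

definition eigenval :: "complex^'n^'n \<Rightarrow> complex \<Rightarrow> bool"
  where "eigenval A c \<longleftrightarrow> (\<exists>v. v \<noteq> 0 \<and> A *v v = c *s v)"

(* The matrix "mat X" is the scalar matrix X Id. *)
definition char_Z :: "complex^'n^'n \<Rightarrow> complex \<Rightarrow> complex"
  where "char_Z U X = det (mat 1 - matrix_inv U ** mat X)"

definition xi :: "complex^'n^'n \<Rightarrow> complex \<Rightarrow> complex"
  where "xi U z = char_Z U (exp (2 * \<i> * pi * z / of_nat CARD('n))) / char_Z U 1"

definition eig_points :: "complex^'n^'n \<Rightarrow> real set"
  where "eig_points U = {real CARD('n) / (2 * pi) * \<theta> | \<theta>. eigenval U (exp (\<i> * of_real \<theta>))}"

definition log_domain :: "complex^'n^'n \<Rightarrow> complex set"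
  where "log_domain U = - {of_real y - \<i> * of_real u | y u. y \<in> eig_points U \<and> u \<ge> 0}"

(* For unitary U with 0 not in "eig_points U", the domain is simply connected and contains 0, and
   xi U has no zero on it, so exactly one continuous logarithm on it vanishes at 0.  The value 0
   outside the domain is a convention, needed for the description to be unique as a total
   function. *)
definition log_xi :: "complex^'n^'n \<Rightarrow> complex \<Rightarrow> complex"
  where "log_xi U = (THE g. continuous_on (log_domain U) g \<and>
    (\<forall>z\<in>log_domain U. exp (g z) = xi U z) \<and> g 0 = 0 \<and> (\<forall>z. z \<notin> log_domain U \<longrightarrow> g z = 0))"

end

theory Submission
  imports Defs "HOL-Computational_Algebra.Fundamental_Theorem_Algebra"
begin

text \<open>
  Almost surely \<open>1\<close> is not an eigenvalue and all eigenspaces are lines: if \<open>F\<close> is an exceptional set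
  and \<open>V\<^sub>0, V\<^sub>1, \<dots>\<close> are unitary matrices such that each \<open>X\<close> has \<open>V\<^sub>i X \<in> F\<close> for at most \<open>n\<close>
  indices, then left invariance forces \<open>F\<close> to be null. One takes for \<open>V\<^sub>i\<close> scalar phases,
  respectively phases in one coordinate. Consequently \<open>\<xi>\<close> has \<open>n\<close> simple zeros \<open>a\<close> modulo \<open>n\<close>, and
  \<open>\<Im> log \<xi>\<close> is, on the real line, the sum over these \<open>a\<close> of the sawtooths
  \<open>\<pi> (frac ((y - a) / n) - \<kappa>)\<close>. Integration by parts against one sawtooth gives the sum of \<open>f\<close>
  over \<open>a + n \<int>\<close> minus \<open>1/n\<close> times the integral of \<open>f\<close>.
\<close>

section \<open>Sums over an arithmetic progression\<close>

text \<open>The half-open cells partition the line. The norms of the cell integrals have partial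
  sums bounded by the integral of \<open>norm (h x)\<close>, so countable additivity yields an
  absolutely convergent series, hence an unordered sum over the integers, which
  \<open>int_decode\<close> enumerates.\<close>

lemma has_sum_integral_cells:
  fixes h :: "real \<Rightarrow> real"
  assumes d: "d > 0" and h: "integrable lborel h"
  shows "((\<lambda>m::int. LINT x:{a + d * m..<a + d * (m + 1)}|lborel. h x) has_sum (LINT x|lborel. h x)) UNIV"
proof -
  define I where "I m = {a + d * of_int m..<a + d * (of_int m + 1)}" for m :: int
  have mem: "x \<in> I m \<longleftrightarrow> \<lfloor>(x - a) / d\<rfloor> = m" for x m
    using d by (auto simp: I_def floor_eq_iff field_simps)
  define A where "A i = I (int_decode i)" for i
  have [measurable]: "A i \<in> sets lborel" for i by (simp add: A_def I_def)
  have A_borel [simp]: "A i \<in> sets borel" for i by (simp add: A_def I_def)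
  have disj: "A i \<inter> A j = {}" if "i \<noteq> j" for i j
    using that by (auto simp: A_def mem int_decode_eq)
  have UN: "(\<Union>i. A i) = UNIV"
  proof -
    have "x \<in> A (int_encode \<lfloor>(x - a) / d\<rfloor>)" for x by (simp add: A_def mem)
    then show ?thesis by blast
  qed
  have set_int: "set_integrable lborel (A i) g" if "integrable lborel g" for g :: "real \<Rightarrow> real" and i
    unfolding set_integrable_def using that by (intro integrable_mult_indicator) auto
  have "summable (\<lambda>i. norm (LINT x:A i|lborel. h x))"
  proof (rule summableI_nonneg_bounded)
    fix N
    have "(\<Sum>i<N. norm (LINT x:A i|lborel. h x)) \<le> (\<Sum>i<N. LINT x:A i|lborel. norm (h x))"
      by (intro sum_mono set_integral_norm_bound set_int h)
    also have "\<dots> = (LINT x:(\<Union>i\<in>{..<N}. A i)|lborel. norm (h x))"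
      using disj by (intro set_integral_finite_Union [symmetric])
        (auto simp: disjoint_family_on_def intro!: set_int integrable_norm h)
    also have "\<dots> \<le> (LINT x|lborel. norm (h x))"
      unfolding set_lebesgue_integral_def
      by (intro integral_mono integrable_mult_indicator integrable_norm h)
        (auto split: split_indicator)
    finally show "(\<Sum>i<N. norm (LINT x:A i|lborel. h x)) \<le> (LINT x|lborel. norm (h x))" .
  qed auto
  moreover have "(\<Sum>i. LINT x:A i|lborel. h x) = (LINT x|lborel. h x)"
    using lebesgue_integral_countable_add[of A lborel h] disj h UN
    by (simp add: set_integrable_def set_lebesgue_integral_def)
  ultimately have "((\<lambda>i. LINT x:A i|lborel. h x) has_sum (LINT x|lborel. h x)) UNIV"
    using norm_summable_imp_has_sum summable_norm_cancel summable_sums by metis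
  then have "((\<lambda>m. LINT x:I m|lborel. h x) has_sum (LINT x|lborel. h x)) UNIV"
    unfolding A_def by (subst (asm) has_sum_reindex_bij_betw[OF bij_int_decode])
  then show ?thesis by (simp add: I_def)
qed

text \<open>A sawtooth integrand is continuous only on a half-open cell; \<open>F'\<close> continues
  it across the right endpoint, which is a null set.\<close>

lemma set_integral_FTC_halfopen:
  fixes F :: "real \<Rightarrow> real"
  assumes ab: "a \<le> b" and F: "\<And>x. (F has_real_derivative F' x) (at x)" and cont: "continuous_on UNIV F'"
    and h: "\<And>x. x \<in> {a..<b} \<Longrightarrow> h x = F' x"
  shows "(LINT x:{a..<b}|lborel. h x) = F b - F a"
proof -
  have [measurable]: "F' \<in> borel_measurable borel"
    using cont by (rule borel_measurable_continuous_onI)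
  have "(LINT x:{a..<b}|lborel. h x) = (LINT x|lborel. indicator {a..<b} x *\<^sub>R F' x)"
    unfolding set_lebesgue_integral_def
    by (intro Bochner_Integration.integral_cong) (auto simp: h split: split_indicator)
  also have "\<dots> = (LINT x|lborel. indicator {a..b} x *\<^sub>R F' x)"
  proof (rule integral_cong_AE)
    show "AE x in lborel. indicator {a..<b} x *\<^sub>R F' x = indicator {a..b} x *\<^sub>R F' x"
      using AE_lborel_singleton[of b] by eventually_elim (auto split: split_indicator)
  qed auto
  also have "\<dots> = F b - F a"
  proof (rule integral_FTC_Icc[OF ab])
    show "(F has_vector_derivative F' x) (at x within {a..b})" for x
      using F[of x] by (simp add: has_real_derivative_iff_has_vector_derivative has_vector_derivative_at_within)
  qed (rule continuous_on_subset[OF cont], simp)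
  finally show ?thesis .
qed

text \<open>Integration by parts on each cell against the sawtooth of period \<open>d\<close>; since \<open>f\<close> is summable
  over the jumps, the integral of \<open>f'\<close> telescopes to zero, and the sawtooth may be shifted by \<open>c\<close>.\<close>
lemma has_sum_lattice:
  fixes f f' :: "real \<Rightarrow> real"
  assumes d: "d > 0" and f: "\<And>x. (f has_real_derivative f' x) (at x)" and cont: "continuous_on UNIV f'"
    and int: "integrable lborel f" and int': "integrable lborel f'"
  shows "((\<lambda>m::int. f (a + d * m)) has_sum
      ((LINT x|lborel. f x) / d + (LINT x|lborel. (frac ((x - a) / d) - c) * f' x))) UNIV"
    and "integrable lborel (\<lambda>x. (frac ((x - a) / d) - c) * f' x)"
proof -
  have int_saw: "integrable lborel (\<lambda>x. (frac ((x - a) / d) - c) * f' x)" for c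
  proof (rule Bochner_Integration.integrable_bound)
    show "integrable lborel (\<lambda>x. (1 + \<bar>c\<bar>) * f' x)" using int' by simp
    show "(\<lambda>x. (frac ((x - a) / d) - c) * f' x) \<in> borel_measurable lborel"
      using int' unfolding frac_def by measurable
    have "\<bar>frac t - c\<bar> \<le> \<bar>1 + \<bar>c\<bar>\<bar>" for t
      using frac_ge_0[of t] frac_lt_1[of t] by linarith
    then show "AE x in lborel. norm ((frac ((x - a) / d) - c) * f' x) \<le> norm ((1 + \<bar>c\<bar>) * f' x)"
      by (intro AE_I2) (auto simp: abs_mult intro!: mult_right_mono)
  qed
  then show "integrable lborel (\<lambda>x. (frac ((x - a) / d) - c) * f' x)" .
  define b where "b m = a + d * of_int m" for m :: int
  define S where "S = (LINT x|lborel. f x / d + (frac ((x - a) / d) - 1) * f' x)"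
  have cell: "(LINT x:{b m..<b (m + 1)}|lborel. f x / d + (frac ((x - a) / d) - 1) * f' x) = f (b m)" for m
  proof -
    \<comment> \<open>The sawtooth shifted by 1 rises from -1 to 0 across the cell, so the boundary
      term survives only at the left endpoint, where it gives \<open>f (b m)\<close>.\<close>
    let ?F = "\<lambda>x. ((x - b m) / d - 1) * f x"
    have "(?F has_real_derivative (f x / d + ((x - b m) / d - 1) * f' x)) (at x)" for x
      using d by (auto intro!: derivative_eq_intros f simp: field_simps)
    moreover have "continuous_on UNIV f"
      using f by (meson DERIV_isCont continuous_at_imp_continuous_on)
    then have "continuous_on UNIV (\<lambda>x. f x / d + ((x - b m) / d - 1) * f' x)"
      using d by (intro continuous_intros cont) auto
    moreover have "f x / d + (frac ((x - a) / d) - 1) * f' x = f x / d + ((x - b m) / d - 1) * f' x"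
      if "x \<in> {b m..<b (m + 1)}" for x
    proof -
      have "\<lfloor>(x - a) / d\<rfloor> = m"
        using that d by (auto simp: b_def floor_eq_iff field_simps)
      then have "frac ((x - a) / d) = (x - b m) / d"
        using d by (simp add: frac_def b_def field_simps)
      then show ?thesis by simp
    qed
    ultimately have "(LINT x:{b m..<b (m + 1)}|lborel. f x / d + (frac ((x - a) / d) - 1) * f' x)
        = ?F (b (m + 1)) - ?F (b m)"
      using d by (intro set_integral_FTC_halfopen[where F' = "\<lambda>x. f x / d + ((x - b m) / d - 1) * f' x"])
        (auto simp: b_def)
    then show ?thesis using d by (simp add: b_def field_simps)
  qed
  have sum_f: "((\<lambda>m. f (b m)) has_sum S) UNIV"
  proof -
    have "integrable lborel (\<lambda>x. f x / d + (frac ((x - a) / d) - 1) * f' x)"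
      using int int_saw by (intro Bochner_Integration.integrable_add) auto
    from has_sum_integral_cells[OF d this, of a] show ?thesis
      using cell by (simp add: S_def b_def)
  qed
  have "bij (\<lambda>m::int. m + 1)"
    by (rule bij_betw_byWitness[where f' = "\<lambda>m. m - 1"]) auto
  then have "((\<lambda>m. f (b (m + 1))) has_sum S) UNIV"
    using sum_f by (subst has_sum_reindex_bij_betw[of "\<lambda>m. m + 1" UNIV UNIV "\<lambda>m. f (b m)"]) auto
  from has_sum_add[OF this has_sum_uminusI[OF sum_f]]
  have "((\<lambda>m. f (b (m + 1)) - f (b m)) has_sum 0) UNIV"
    by simp
  moreover have "(LINT x:{b m..<b (m + 1)}|lborel. f' x) = f (b (m + 1)) - f (b m)" for m
    using d by (intro set_integral_FTC_halfopen[OF _ f cont]) (auto simp: b_def)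
  ultimately have zero: "(LINT x|lborel. f' x) = 0"
    using has_sum_integral_cells[OF d int', of a] by (simp add: b_def has_sum_unique)
  have "S = (LINT x|lborel. f x) / d + (LINT x|lborel. (frac ((x - a) / d) - c) * f' x + (c - 1) * f' x)"
    unfolding S_def using int int_saw[of 1]
    by (subst Bochner_Integration.integral_add) (simp_all add: algebra_simps)
  also have "\<dots> = (LINT x|lborel. f x) / d + (LINT x|lborel. (frac ((x - a) / d) - c) * f' x)"
    using int' int_saw zero by (subst Bochner_Integration.integral_add) simp_all
  finally show "((\<lambda>m::int. f (a + d * m)) has_sum
      ((LINT x|lborel. f x) / d + (LINT x|lborel. (frac ((x - a) / d) - c) * f' x))) UNIV"
    using sum_f by (simp add: b_def)
qed

text \<open>Outside \<open>{-1..1}\<close> the factor \<open>x\<close> only enlarges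
  \<open>g\<close>, and on this compact interval continuity suffices. Meant for the derivative of
  \<open>f\<close>.\<close>

lemma integrable_of_integrable_times:
  fixes g :: "real \<Rightarrow> real"
  assumes cont: "continuous_on UNIV g" and fin: "(\<integral>\<^sup>+x. ennreal \<bar>x * g x\<bar> \<partial>lborel) < \<infinity>"
  shows "integrable lborel g"
proof (rule Bochner_Integration.integrable_bound)
  have [measurable]: "g \<in> borel_measurable borel"
    using cont by (rule borel_measurable_continuous_onI)
  then show "g \<in> borel_measurable lborel" by simp
  have "integrable lborel (\<lambda>x. x * g x)"
    using fin by (intro integrableI_bounded) auto
  moreover have "integrable lborel (\<lambda>x. indicator {-1..1} x *\<^sub>R g x)"
    using cont by (intro borel_integrable_compact) (auto intro: continuous_on_subset)
  ultimately show "integrable lborel (\<lambda>x. \<bar>x * g x\<bar> + \<bar>indicator {-1..1} x *\<^sub>R g x\<bar>)"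
    by (intro Bochner_Integration.integrable_add integrable_abs)
  have "\<bar>g x\<bar> \<le> \<bar>x\<bar> * \<bar>g x\<bar>" if "x \<notin> {-1..1}" for x
    using that mult_right_mono[of 1 "\<bar>x\<bar>" "\<bar>g x\<bar>"] by auto
  then show "AE x in lborel. norm (g x) \<le> norm (\<bar>x * g x\<bar> + \<bar>indicator {-1..1} x *\<^sub>R g x\<bar>)"
    by (intro AE_I2) (auto simp: abs_mult split: split_indicator)
qed

section \<open>Eigenvalues of unitary matrices\<close>

definition cdot :: "complex^'n \<Rightarrow> complex^'n \<Rightarrow> complex"
  where "cdot u v = (\<Sum>i\<in>UNIV. cnj (u $ i) * v $ i)"

lemma cdot_scale_right: "cdot u (c *s v) = c * cdot u v"
  by (simp add: cdot_def sum_distrib_left mult_ac)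

lemma cdot_self_eq_0: "cdot v v = 0 \<longleftrightarrow> v = 0"
proof -
  have "cdot v v = of_real (\<Sum>i\<in>UNIV. (cmod (v $ i))\<^sup>2)"
    unfolding cdot_def of_real_sum by (intro sum.cong refl) (metis complex_norm_square mult.commute)
  then show ?thesis by (simp add: sum_nonneg_eq_0_iff vec_eq_iff del: of_real_sum)
qed

lemma cdot_unitary:
  fixes A :: "complex^'n^'n"
  assumes "A \<in> unitary_group"
  shows "cdot (A *v u) (A *v v) = cdot u v"
proof -
  have orth: "(\<Sum>i\<in>UNIV. cnj (A $ i $ j) * A $ i $ k) = (if j = k then 1 else 0)" for j k
  proof -
    have "(conj_transpose A ** A) $ j $ k = (mat 1 :: complex^'n^'n) $ j $ k"
      using assms by (simp add: unitary_group_def)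
    then show ?thesis by (simp add: matrix_matrix_mult_def conj_transpose_def mat_def)
  qed
  have "cdot (A *v u) (A *v v) =
      (\<Sum>i\<in>UNIV. \<Sum>j\<in>UNIV. \<Sum>k\<in>UNIV. cnj (u $ j) * (cnj (A $ i $ j) * A $ i $ k) * v $ k)"
    unfolding cdot_def matrix_vector_mult_def vec_lambda_beta cnj_sum sum_product by (simp add: mult_ac)
  also have "\<dots> = (\<Sum>j\<in>UNIV. \<Sum>k\<in>UNIV. \<Sum>i\<in>UNIV. cnj (u $ j) * (cnj (A $ i $ j) * A $ i $ k) * v $ k)"
    by (rule trans[OF sum.swap], rule sum.cong[OF refl], rule sum.swap)
  also have "\<dots> = (\<Sum>j\<in>UNIV. \<Sum>k\<in>UNIV. cnj (u $ j) * (\<Sum>i\<in>UNIV. cnj (A $ i $ j) * A $ i $ k) * v $ k)"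
    by (simp add: sum_distrib_left sum_distrib_right)
  also have "\<dots> = cdot u v"
    by (simp add: orth cdot_def if_distrib if_distribR cong: if_cong)
  finally show ?thesis .
qed

lemma unitary_mult:
  assumes "A \<in> unitary_group" "B \<in> unitary_group"
  shows "A ** B \<in> unitary_group"
proof -
  have ct: "conj_transpose (A ** B) = conj_transpose B ** conj_transpose A"
    by (simp add: conj_transpose_def matrix_matrix_mult_def vec_eq_iff mult.commute)
  have "conj_transpose (A ** B) ** (A ** B) = conj_transpose B ** (conj_transpose A ** A) ** B"
    "(A ** B) ** conj_transpose (A ** B) = A ** (B ** conj_transpose B) ** conj_transpose A"
    by (simp_all add: ct matrix_mul_assoc)
  then show ?thesis using assms by (simp add: unitary_group_def)
qed

text \<open>\<open>matrix_inv\<close> chooses some two-sided inverse; one exists, and multiplying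
  \<open>U ** matrix_inv U = mat 1\<close> by the conjugate transpose identifies it.\<close>

lemma unitary_matrix_inv:
  assumes "U \<in> unitary_group"
  shows "matrix_inv U = conj_transpose U"
proof -
  have "\<exists>V. U ** V = mat 1 \<and> V ** U = mat 1"
    using assms by (auto simp: unitary_group_def)
  then have "U ** matrix_inv U = mat 1"
    unfolding matrix_inv_def by (rule someI2_ex) auto
  then have "conj_transpose U ** U ** matrix_inv U = conj_transpose U"
    by (simp flip: matrix_mul_assoc)
  then show ?thesis using assms by (simp add: unitary_group_def)
qed

text \<open>The right-hand side is the kernel equation of
  \<open>mat 1 - conj_transpose U ** mat c\<close>, the matrix inside \<open>char_Z\<close>. It
  results from applying \<open>conj_transpose U\<close>, and is undone by applying
  \<open>U\<close>.\<close>

lemma unitary_eigen_iff: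
  assumes U: "U \<in> unitary_group"
  shows "U *v v = c *s v \<longleftrightarrow> v = c *s (conj_transpose U *v v)"
proof
  assume "U *v v = c *s v"
  then have "conj_transpose U *v (U *v v) = c *s (conj_transpose U *v v)"
    by (simp add: vector_scalar_commute)
  then show "v = c *s (conj_transpose U *v v)"
    using U by (simp add: matrix_vector_mul_assoc unitary_group_def)
next
  assume *: "v = c *s (conj_transpose U *v v)"
  have "U *v v = c *s (U *v (conj_transpose U *v v))"
    by (subst *) (simp add: vector_scalar_commute)
  then show "U *v v = c *s v"
    using U by (simp add: matrix_vector_mul_assoc unitary_group_def)
qed

lemma norm_unitary_eigenval:
  assumes "U \<in> unitary_group" "eigenval U c"
  shows "cmod c = 1"
proof -
  obtain v where v: "v \<noteq> 0" "U *v v = c *s v" using assms by (auto simp: eigenval_def)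
  have "cdot v v = cdot (c *s v) (c *s v)"
    using cdot_unitary[OF assms(1), of v v] v by simp
  also have "\<dots> = cnj c * c * cdot v v"
    by (simp add: cdot_def sum_distrib_left mult_ac)
  finally have "cnj c * c = 1" using v cdot_self_eq_0 by auto
  then have "cmod c * cmod c = 1" by (metis complex_mod_cnj norm_mult norm_one)
  then show ?thesis using norm_ge_zero[of c] by (auto simp: square_eq_1_iff)
qed

section \<open>The polynomial \<open>det (mat 1 - M ** mat x)\<close> in \<open>x\<close> and its
  roots\<close>

lemma mat_component: "mat x $ i $ j = (if i = j then x else 0)"
  by (simp add: mat_def)

lemma matrix_mult_mat_component:
  fixes A :: "complex^'n^'n"
  shows "(A ** mat x) $ i $ j = A $ i $ j * x"
  by (simp add: matrix_matrix_mult_def mat_def if_distrib if_distribR cong: if_cong)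

lemma mat_mult_mat: "mat a ** mat b = (mat (a * b) :: complex^'n^'n)"
  by (simp add: vec_eq_iff matrix_mult_mat_component mat_component)

text \<open>Each product in the Leibniz expansion is a product of \<open>CARD('n)\<close>
  polynomials of degree at most 1. The coefficient at \<open>CARD('n)\<close> is recorded instead of
  the degree, since \<open>M\<close> may be singular.\<close>

lemma char_poly_exists:
  fixes M :: "complex^'n^'n"
  obtains p where "degree p \<le> CARD('n)" "coeff p CARD('n) = det (- M)"
    "\<And>x. poly p x = det (mat 1 - M ** mat x)"
proof -
  define q where "q \<sigma> A = (\<Prod>i\<in>A. [:(mat 1 :: complex^'n^'n) $ i $ \<sigma> i, - M $ i $ \<sigma> i:])" for \<sigma> A
  have q: "degree (q \<sigma> A) \<le> card A \<and> coeff (q \<sigma> A) (card A) = (\<Prod>i\<in>A. (- M) $ i $ \<sigma> i)"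
    if "finite A" for A \<sigma>
    using that
  proof (induction A)
    case (insert a A)
    then have "coeff (q \<sigma> A) (Suc (card A)) = 0" by (intro coeff_eq_0) simp
    with insert show ?case
      by (auto simp: q_def intro!: order.trans[OF degree_add_le_max] degree_pCons_le order.trans[OF degree_smult_le])
  qed (simp add: q_def)
  define p where "p = (\<Sum>\<sigma> | \<sigma> permutes (UNIV :: 'n set). smult (of_int (sign \<sigma>)) (q \<sigma> UNIV))"
  show thesis
  proof
    show "degree p \<le> CARD('n)"
      unfolding p_def using q[of UNIV]
      by (intro degree_sum_le) (auto intro: order.trans[OF degree_smult_le] finite_permutations)
    show "coeff p CARD('n) = det (- M)"
      using q[of UNIV] by (simp add: p_def coeff_sum det_def)
    show "poly p x = det (mat 1 - M ** mat x)" for x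
      by (simp add: p_def q_def poly_sum poly_prod det_def matrix_mult_mat_component mult.commute)
  qed
qed

lemma det_eq_0_iff_kernel:
  fixes A :: "complex^'n^'n"
  shows "det A = 0 \<longleftrightarrow> (\<exists>v. v \<noteq> 0 \<and> A *v v = 0)"
  using matrix_left_invertible_ker[of A] invertible_det_nz[of A] invertible_left_inverse[of A] by metis

lemma matrix_vector_mult_one_minus:
  fixes M :: "complex^'n^'n"
  shows "(mat 1 - M ** mat x) *v v = v - x *s (M *v v)"
proof -
  have "mat x *v v = x *s v" for v :: "complex^'n"
    by (simp add: matrix_vector_mult_def mat_def vec_eq_iff if_distrib if_distribR cong: if_cong)
  then show ?thesis
    by (simp add: matrix_vector_mult_diff_rdistrib vector_scalar_commute flip: matrix_vector_mul_assoc)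
qed

lemma det_eq_0_iff_eigenval:
  assumes "U \<in> unitary_group"
  shows "det (mat 1 - conj_transpose U ** mat c) = 0 \<longleftrightarrow> eigenval U c"
  using assms by (simp add: det_eq_0_iff_kernel matrix_vector_mult_one_minus eigenval_def unitary_eigen_iff)

text \<open>The eigenvalues are the roots of a polynomial with value 1 at 0, which is therefore
  nonzero.\<close>

lemma eigenvals_finite_card:
  fixes U :: "complex^'n^'n"
  assumes "U \<in> unitary_group"
  shows "finite {c. eigenval U c}" "card {c. eigenval U c} \<le> CARD('n)"
proof -
  obtain p where p: "degree p \<le> CARD('n)" "\<And>x. poly p x = det (mat 1 - conj_transpose U ** mat x)"
    using char_poly_exists[of "conj_transpose U"] by blast
  have "poly p 0 = 1" by (simp add: p)
  then have "p \<noteq> 0" by auto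
  moreover have "{c. eigenval U c} = {c. poly p c = 0}"
    using assms by (simp add: p det_eq_0_iff_eigenval)
  ultimately show "finite {c. eigenval U c}" "card {c. eigenval U c} \<le> CARD('n)"
    using poly_roots_finite card_poly_roots_bound[of p] p(1) by auto
qed

section \<open>Simple eigenspaces give simple roots\<close>

text \<open>The matrix determinant lemma. The multiples of \<open>y\<close> are added one row at a
  time: linearity in row \<open>a\<close> splits off a determinant having \<open>y\<close> itself as
  row \<open>a\<close>.\<close>

lemma det_rank_one:
  fixes x y :: "complex^'n"
  shows "det (\<chi> i. axis i 1 + x $ i *s y) = 1 + (\<Sum>i\<in>UNIV. x $ i * y $ i)"
proof -
  let ?c = "\<lambda>S i. axis i 1 + (if i \<in> S then x $ i *s y else 0)"
  \<comment> \<open>Once row \<open>a\<close> is \<open>y\<close>, multiples of \<open>y\<close> in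
    the other rows can be removed by row operations; what remains is the identity with one row
    replaced.\<close>
  have replace: "det (\<chi> i. if i = a then y else ?c S i) = y $ a" if "finite S" "a \<notin> S" for S a
    using that
  proof (induction S)
    case empty
    have "(\<Sum>i\<in>UNIV. y $ i *s row i (mat 1 :: complex^'n^'n)) = y"
      by (simp add: vec_eq_iff row_def mat_def if_distrib if_distribR cong: if_cong)
    moreover have "row i (mat 1) = (axis i 1 :: complex^'n)" for i
      by (simp add: vec_eq_iff row_def mat_def axis_def)
    ultimately show ?case
      using cramer_lemma_transpose[where x = y and k = a and A = "mat 1"] by (simp cong: if_cong)
  next
    case (insert b S)
    let ?A = "\<chi> i. if i = a then y else ?c S i"
    have "b \<noteq> a" using insert by auto
    then have "det (\<chi> k. if k = b then row b ?A + x $ b *s row a ?A else row k ?A) = det ?A"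
      by (rule det_row_operation)
    moreover have "(\<chi> k. if k = b then row b ?A + x $ b *s row a ?A else row k ?A)
        = (\<chi> i. if i = a then y else ?c (insert b S) i)"
      using insert by (auto simp: vec_eq_iff row_def)
    ultimately show ?case using insert by simp
  qed
  have "det (\<chi> i. ?c S i) = 1 + (\<Sum>i\<in>S. x $ i * y $ i)" if "finite S" for S
    using that
  proof (induction S)
    case empty
    have "(\<chi> i. axis i 1) = (mat 1 :: complex^'n^'n)"
      by (simp add: vec_eq_iff mat_def axis_def)
    then show ?case by simp
  next
    case (insert a S)
    have "(\<chi> i. ?c (insert a S) i) = (\<chi> i. if i = a then axis a 1 + x $ a *s y else ?c S i)"
      by (auto simp: vec_eq_iff)
    then have "det (\<chi> i. ?c (insert a S) i) =
        det (\<chi> i. if i = a then axis a 1 else ?c S i) + x $ a * det (\<chi> i. if i = a then y else ?c S i)"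
      by (simp only: det_row_add det_row_mul)
    moreover have "(\<chi> i. if i = a then axis a 1 else ?c S i) = (\<chi> i. ?c S i)"
      using insert by (auto simp: vec_eq_iff)
    ultimately show ?case using insert replace[of S a] by (simp add: algebra_simps)
  qed
  from this[of UNIV] show ?thesis by simp
qed

lemma matrix_diff_ldistrib:
  fixes A B C :: "complex^'n^'n"
  shows "A ** (B - C) = A ** B - A ** C" "(A - B) ** C = A ** C - B ** C"
  by (simp_all add: matrix_matrix_mult_def vec_eq_iff algebra_simps sum_subtractf)

lemma mat_commute:
  fixes A :: "complex^'n^'n"
  shows "mat c ** A = A ** mat c"
  by (simp add: matrix_matrix_mult_def mat_def vec_eq_iff if_distrib if_distribR mult.commute cong: if_cong)

text \<open>Deflation: with \<open>K\<close> the orthogonal projection onto the eigenline and \<open>C = B - K / c\<close>,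
  one has \<open>1 - x B = (1 - x C) (1 - x K / c)\<close>, the second factor has determinant \<open>1 - x / c\<close>,
  and the first factor stays invertible at \<open>x = c\<close>.\<close>
lemma simple_eigenspace_imp_simple_root:
  fixes U :: "complex^'n^'n"
  assumes U: "U \<in> unitary_group" and v: "v \<noteq> 0" "U *v v = c *s v"
    and simple: "\<And>w. U *v w = c *s w \<Longrightarrow> \<exists>a. w = a *s v"
    and p: "\<And>x. poly p x = det (mat 1 - conj_transpose U ** mat x)"
  shows "poly (pderiv p) c \<noteq> 0"
proof -
  define B where "B = conj_transpose U"
  have "cmod c = 1" using norm_unitary_eigenval[OF U] v by (auto simp: eigenval_def)
  then have c: "cmod c = 1" "c \<noteq> 0" by auto
  then have cnj_c: "cnj c = 1 / c"
    by (metis complex_div_cnj div_by_1 of_real_1 mult_1 power_one)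
  define s where "s = cdot v v"
  have s: "s \<noteq> 0" using v by (simp add: s_def cdot_self_eq_0)
  define K :: "complex^'n^'n" where "K = (\<chi> i j. v $ i * cnj (v $ j) / s)"
  have Kv: "K *v w = (cdot v w / s) *s v" for w
    by (simp add: K_def matrix_vector_mult_def cdot_def vec_eq_iff sum_distrib_left sum_divide_distrib mult_ac)
  have KK: "K ** K = K"
    using s by (simp add: matrix_eq Kv cdot_scale_right flip: matrix_vector_mul_assoc s_def)
  have Bv: "B *v v = (1 / c) *s v"
  proof -
    have "v = c *s (B *v v)" using v unitary_eigen_iff[OF U] by (simp add: B_def)
    then have "(1 / c) *s v = (1 / c) *s (c *s (B *v v))" by simp
    then show ?thesis using c by (simp add: vector_smult_assoc)
  qed
  have BK: "B ** K = K ** mat (1 / c)"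
    unfolding mat_commute[of _ K, symmetric]
    by (simp add: matrix_eq Kv Bv vector_scalar_commute mult.commute flip: matrix_vector_mul_assoc)
      (simp add: matrix_vector_mult_def mat_def vec_eq_iff if_distrib if_distribR cong: if_cong)
  have KB: "K ** B = K ** mat (1 / c)"
  proof -
    \<comment> \<open>Conjugating the eigenvalue equation makes the conjugate of \<open>v\<close> a
      left eigenvector of \<open>B\<close>, with eigenvalue \<open>cnj c = 1 / c\<close>.\<close>
    have "(\<Sum>k\<in>UNIV. cnj (v $ k) * B $ k $ j) = cnj (v $ j) / c" for j
    proof -
      have "(U *v v) $ j = c * v $ j" using v by simp
      then have "cnj (\<Sum>k\<in>UNIV. U $ j $ k * v $ k) = cnj (c * v $ j)"
        by (simp add: matrix_vector_mult_def)
      then show ?thesis by (simp add: B_def conj_transpose_def cnj_c mult.commute)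
    qed
    then have "(\<Sum>k\<in>UNIV. v $ i * cnj (v $ k) / s * B $ k $ j) = v $ i * cnj (v $ j) / s * (1 / c)" for i j
      by (simp add: sum_distrib_left[symmetric] mult.assoc divide_inverse mult.left_commute)
    then show ?thesis
      by (simp add: vec_eq_iff K_def matrix_matrix_mult_def mat_def if_distrib if_distribR cong: if_cong)
  qed
  define C where "C = B - K ** mat (1 / c)"
  have KC: "K ** C = 0"
    by (simp add: C_def matrix_diff_ldistrib KB matrix_mul_assoc KK)
  have CK: "C ** K = 0"
  proof -
    have "K ** mat (1 / c) ** K = K ** K ** mat (1 / c)"
      by (metis mat_commute matrix_mul_assoc)
    then show ?thesis by (simp add: C_def matrix_diff_ldistrib BK KK)
  qed
  obtain q where q: "\<And>x. poly q x = det (mat 1 - C ** mat x)"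
    using char_poly_exists[of C] by blast
  have factor: "poly p x = poly q x * (1 - x / c)" for x
  proof -
    have "mat 1 - B ** mat x = (mat 1 - C ** mat x) ** (mat 1 - K ** mat (x / c))"
    proof -
      \<comment> \<open>The cross term of the product contains \<open>C ** K\<close>, which is zero;
        the two linear terms add up to \<open>B ** mat x\<close>.\<close>
      have "C ** mat x ** (K ** mat (x / c)) = C ** K ** mat x ** mat (x / c)"
        by (metis mat_commute matrix_mul_assoc)
      also have "\<dots> = 0"
        by (simp add: CK)
      finally have "C ** mat x ** (K ** mat (x / c)) = 0" .
      moreover have "K ** mat (1 / c) ** mat x = K ** mat (x / c)"
        by (simp add: mat_mult_mat flip: matrix_mul_assoc)
      ultimately show ?thesis
        by (simp add: matrix_diff_ldistrib C_def)
    qed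
    moreover have "det (mat 1 - K ** mat (x / c)) = 1 - x / c"
    proof -
      have "mat 1 - K ** mat (x / c) = (\<chi> i. axis i 1 + (((- x / c / s) *s v) $ i) *s (\<chi> j. cnj (v $ j)))"
        by (auto simp: K_def vec_eq_iff matrix_mult_mat_component mat_component axis_def mult_ac)
      also have "det \<dots> = 1 + (- x / c / s) * s"
      proof -
        have "(\<Sum>i\<in>UNIV. (r *s v) $ i * (\<chi> j. cnj (v $ j)) $ i) = r * s" for r
          by (simp add: s_def cdot_def sum_distrib_left mult_ac)
        then show ?thesis by (simp only: det_rank_one)
      qed
      finally show ?thesis using s by simp
    qed
    ultimately show ?thesis by (simp add: p q det_mul flip: B_def)
  qed
  have "poly q c \<noteq> 0"
  proof
    assume "poly q c = 0"
    \<comment> \<open>Such a \<open>w\<close> satisfies \<open>K *v w = 0\<close> because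
      \<open>K ** C = 0\<close>, so \<open>C\<close> and \<open>B\<close> agree on it and it is an
      eigenvector of \<open>U\<close> for \<open>c\<close>. As a multiple of \<open>v\<close> it
      would also be fixed by \<open>K\<close>.\<close>
    then obtain w where w: "w \<noteq> 0" "w = c *s (C *v w)"
      by (auto simp: q det_eq_0_iff_kernel matrix_vector_mult_one_minus)
    have "K *v w = c *s (K *v (C *v w))"
      by (subst w(2)) (simp add: vector_scalar_commute)
    then have Kw: "K *v w = 0" by (simp add: matrix_vector_mul_assoc KC)
    have "C *v w = B *v w"
      by (simp add: C_def matrix_vector_mult_diff_rdistrib Kw mat_commute[of _ K, symmetric]
          flip: matrix_vector_mul_assoc)
    then have "U *v w = c *s w" using w unitary_eigen_iff[OF U] by (simp add: B_def)
    then obtain a where "w = a *s v" using simple by blast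
    then have "K *v w = w" using s by (simp add: Kv cdot_scale_right flip: s_def)
    with Kw w show False by simp
  qed
  \<comment> \<open>The linear factor vanishes at \<open>c\<close>, so the product rule leaves only
    the term with its derivative.\<close>
  moreover have "p = q * [:1, - 1 / c:]"
    unfolding poly_eq_poly_eq_iff[symmetric] by (rule ext) (simp add: factor algebra_simps)
  then have "pderiv p = q * pderiv [:1, - 1 / c:] + [:1, - 1 / c:] * pderiv q"
    by (simp only: pderiv_mult)
  then have "poly (pderiv p) c = - poly q c / c"
    using c by (simp add: pderiv_pCons)
  ultimately show ?thesis using c by simp
qed

section \<open>Simplicity of the spectrum under Haar measure\<close>

text \<open>An open set is a countable union of compact sets, so the image is a countable union of
  compact sets. In the applications the eigenvector equations give the closed set and the
  nonvanishing conditions the open one.\<close>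

lemma borel_projection:
  fixes C O' :: "('a::euclidean_space \<times> 'b::euclidean_space) set"
  assumes "closed C" "open O'"
  shows "fst ` (C \<inter> O') \<in> sets borel"
proof -
  obtain K where K: "\<And>n::nat. compact (K n)" "\<Union>(range K) = O'"
    using open_Union_compact_subsets[OF assms(2)] by metis
  have "fst ` (C \<inter> O') = (\<Union>n. fst ` (C \<inter> K n))"
    using K(2) by blast
  also have "\<dots> \<in> sets borel"
  proof (intro sets.countable_UN image_subsetI)
    fix n
    have "compact (C \<inter> K n)" using K(1) assms(1) by (simp add: closed_Int_compact)
    then have "compact (fst ` (C \<inter> K n))"
      by (intro compact_continuous_image continuous_on_fst continuous_on_id)
    then show "fst ` (C \<inter> K n) \<in> sets borel" by (intro borel_closed compact_imp_closed)
  qed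
  finally show ?thesis .
qed

lemma haar_space: "haar_unitary M \<Longrightarrow> space M = unitary_group"
  using sets_eq_imp_space_eq[of M borel_unitary] by (auto simp: haar_unitary_def space_restrict_space)

lemma haar_sets: "haar_unitary M \<Longrightarrow> A \<in> sets borel \<Longrightarrow> A \<inter> unitary_group \<in> sets M"
  by (auto simp: haar_unitary_def sets_restrict_space)

text \<open>By invariance the \<open>N\<close> translates of \<open>F\<close> have the same measure, and they cover each point
  at most \<open>K\<close> times, so \<open>N\<close> times the measure of \<open>F\<close> is at most \<open>K\<close>.\<close>
lemma haar_null_sets_translates:
  fixes M :: "(complex^'n^'n) measure" and V :: "nat \<Rightarrow> complex^'n^'n"
  assumes haar: "haar_unitary M" and F: "F \<in> sets M" and V: "\<And>i. V i \<in> unitary_group"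
    and card: "\<And>X. X \<in> unitary_group \<Longrightarrow> finite {i. V i ** X \<in> F} \<and> card {i. V i ** X \<in> F} \<le> K"
  shows "F \<in> null_sets M"
proof -
  interpret prob_space M using haar by (simp add: haar_unitary_def)
  have space: "space M = unitary_group" by (rule haar_space[OF haar])
  have sets: "sets M = sets borel_unitary" using haar by (simp add: haar_unitary_def)
  have [measurable]: "(\<lambda>X. V i ** X) \<in> measurable M M" for i
  proof -
    have "linear (\<lambda>X. V i ** X)"
      by (intro linearI) (simp_all add: matrix_add_ldistrib matrix_scalar_ac scalar_matrix_assoc)
    then have "(\<lambda>X. V i ** X) \<in> borel_measurable borel"
      by (intro borel_measurable_continuous_onI linear_continuous_on) (simp add: linear_conv_bounded_linear)
    then have "(\<lambda>X. V i ** X) \<in> measurable borel_unitary borel_unitary"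
      using V by (intro measurable_restrict_space2 measurable_restrict_space1)
        (auto simp: space_restrict_space intro: unitary_mult)
    then show ?thesis by (simp add: measurable_cong_sets[OF sets sets])
  qed
  define G where "G i = {X \<in> space M. V i ** X \<in> F}" for i
  have G [measurable]: "G i \<in> sets M" for i unfolding G_def using F by measurable
  have "prob (G i) = prob F" for i
  proof -
    have "prob F = measure (distr M M (\<lambda>X. V i ** X)) F"
      using haar V by (simp add: haar_unitary_def)
    then show ?thesis using F by (simp add: measure_distr G_def vimage_def Int_def conj_commute)
  qed
  moreover have "(\<Sum>i<N. prob (G i)) \<le> K" for N
  proof -
    have "(\<Sum>i<N. prob (G i)) = (\<integral>X. (\<Sum>i<N. indicator (G i) X) \<partial>M)"
      by (subst Bochner_Integration.integral_sum) (auto simp: G emeasure_eq_measure)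
    also have "\<dots> \<le> (\<integral>X. real K \<partial>M)"
    proof (rule integral_mono)
      fix X assume X: "X \<in> space M"
      have "(\<Sum>i<N. indicator (G i) X) = real (card ({..<N} \<inter> {i. V i ** X \<in> F}))"
        using X by (simp add: G_def indicator_def sum.If_cases)
      also have "\<dots> \<le> real (card {i. V i ** X \<in> F})"
        using card[of X] X space by (intro of_nat_mono card_mono) auto
      also have "\<dots> \<le> real K" using card[of X] X space by simp
      finally show "(\<Sum>i<N. indicator (G i) X) \<le> real K" .
    qed (auto simp: emeasure_eq_measure intro!: Bochner_Integration.integrable_sum)
    finally show ?thesis by (simp add: prob_space)
  qed
  ultimately have bound: "real N * prob F \<le> real K" for N by simp
  have "prob F = 0"
  proof (rule ccontr)
    assume "prob F \<noteq> 0"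
    then have "prob F > 0" by (simp add: zero_less_measure_iff)
    then obtain N where "real K < real N * prob F" using reals_Archimedean3 by blast
    with bound[of N] show False by simp
  qed
  then show ?thesis using F by (simp add: null_sets_def emeasure_eq_measure)
qed

section \<open>Null sets: the eigenvalue 1 and multiple eigenvalues\<close>

text \<open>An injective sequence on the unit circle; its angles lie in (0, 1], where
  \<open>Arg\<close> recovers them.\<close>

definition phase :: "nat \<Rightarrow> complex"
  where "phase i = cis (1 / (real i + 1))"

lemma norm_phase [simp]: "cmod (phase i) = 1"
  by (simp add: phase_def)

lemma phase_nz [simp]: "phase i \<noteq> 0"
  using norm_phase[of i] by (metis norm_zero zero_neq_one)

lemma cnj_phase: "cnj (phase i) * phase i = 1"
  by (metis complex_norm_square mult.commute norm_phase of_real_1 one_power2)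

lemma inj_phase: "inj phase"
proof (rule injI)
  fix i j assume "phase i = phase j"
  moreover have "Arg (phase k) = 1 / (real k + 1)" for k
  proof -
    have "0 < 1 / (real k + 1)" "1 / (real k + 1) \<le> 1" by (auto simp: field_simps)
    then have "- pi < 1 / (real k + 1)" "1 / (real k + 1) \<le> pi" using pi_gt3 by linarith+
    then show ?thesis unfolding phase_def by (intro Arg_cis) simp
  qed
  ultimately have "1 / (real i + 1) = 1 / (real j + 1)" by metis
  then show "i = j" by simp
qed

text \<open>If 1 is an eigenvalue of \<open>X\<close> times a phase, the conjugate phase is an
  eigenvalue of \<open>X\<close>. Distinct phases use up distinct eigenvalues.\<close>

lemma haar_null_eigenval_1:
  fixes M :: "(complex^'n^'n) measure"
  assumes haar: "haar_unitary M"
  shows "{X \<in> unitary_group. eigenval X 1} \<in> null_sets M"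
proof (rule haar_null_sets_translates[OF haar])
  let ?C = "{z :: (complex^'n^'n) \<times> (complex^'n). fst z *v snd z = snd z}"
  let ?O = "{z :: (complex^'n^'n) \<times> (complex^'n). snd z \<noteq> 0}"
  have "closed ?C"
    unfolding matrix_vector_mult_def by (intro closed_Collect_eq continuous_intros)
  moreover have "open ?O" by (intro open_Collect_neq continuous_intros)
  ultimately have "fst ` (?C \<inter> ?O) \<in> sets borel" by (rule borel_projection)
  moreover have "fst ` (?C \<inter> ?O) = {X. eigenval X 1}"
    by (auto simp: eigenval_def image_iff Bex_def)
  ultimately show "{X \<in> unitary_group. eigenval X 1} \<in> sets M"
    using haar_sets[OF haar] by (metis Collect_conj_eq Collect_mem_eq Int_commute)
  have scalar: "mat c *v v = c *s v" for c and v :: "complex^'n"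
    by (simp add: matrix_vector_mult_def mat_def vec_eq_iff if_distrib if_distribR cong: if_cong)
  show V: "(mat (phase i) :: complex^'n^'n) \<in> unitary_group" for i
  proof -
    have "conj_transpose (mat (phase i)) = (mat (cnj (phase i)) :: complex^'n^'n)"
      by (auto simp: conj_transpose_def mat_def vec_eq_iff)
    then show ?thesis by (simp add: unitary_group_def mat_mult_mat cnj_phase mult.commute[of "phase i"])
  qed
  fix X :: "complex^'n^'n" assume X: "X \<in> unitary_group"
  let ?I = "{i. mat (phase i) ** X \<in> {X \<in> unitary_group. eigenval X 1}}"
  have "eigenval X (cnj (phase i))" if "i \<in> ?I" for i
  proof -
    from that obtain v where "v \<noteq> 0" "(mat (phase i) ** X) *v v = v"
      by (auto simp: eigenval_def)
    then have v: "v \<noteq> 0" "phase i *s (X *v v) = v"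
      by (simp_all add: scalar flip: matrix_vector_mul_assoc)
    then have "cnj (phase i) *s v = cnj (phase i) *s (phase i *s (X *v v))" by simp
    then have "X *v v = cnj (phase i) *s v" by (simp add: vector_smult_assoc cnj_phase)
    then show ?thesis using v by (auto simp: eigenval_def)
  qed
  then have "(\<lambda>i. cnj (phase i)) ` ?I \<subseteq> {c. eigenval X c}" by auto
  moreover have "inj_on (\<lambda>i. cnj (phase i)) ?I"
    using inj_phase by (auto simp: inj_on_def)
  ultimately show "finite ?I \<and> card ?I \<le> CARD('n)"
    using eigenvals_finite_card[OF X] by (meson card_inj_on_le inj_on_finite le_trans)
qed

text \<open>Detects an eigenspace of dimension at least 2 through a single coordinate: inside it,
  some nonzero \<open>u\<close> vanishes at \<open>j\<close>, while for a suitable \<open>j\<close>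
  some \<open>v\<close> does not. One coordinate is all that the perturbation below alters.\<close>

definition multiple_at :: "'n \<Rightarrow> complex^'n^'n \<Rightarrow> bool"
  where "multiple_at j X \<longleftrightarrow> (\<exists>c u v. X *v u = c *s u \<and> X *v v = c *s v \<and> u $ j = 0 \<and> u \<noteq> 0 \<and> v $ j \<noteq> 0)"

text \<open>Changing the phase of the \<open>j\<close>-th coordinate keeps \<open>u\<close> an eigenvector with the same eigenvalue
  \<open>c\<close>, whereas \<open>v\<close> can belong to \<open>c\<close> for one phase only: so the exceptional phases inject into the
  eigenvalues of \<open>X\<close>.\<close>
lemma haar_null_multiple_at:
  fixes M :: "(complex^'n^'n) measure"
  assumes haar: "haar_unitary M"
  shows "{X \<in> unitary_group. multiple_at j X} \<in> null_sets M"
proof (rule haar_null_sets_translates[OF haar])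
  let ?C = "{z :: (complex^'n^'n) \<times> complex \<times> (complex^'n) \<times> (complex^'n).
    fst z *v fst (snd (snd z)) = fst (snd z) *s fst (snd (snd z)) \<and>
    fst z *v snd (snd (snd z)) = fst (snd z) *s snd (snd (snd z)) \<and> fst (snd (snd z)) $ j = 0}"
  let ?O = "{z :: (complex^'n^'n) \<times> complex \<times> (complex^'n) \<times> (complex^'n).
    fst (snd (snd z)) \<noteq> 0 \<and> snd (snd (snd z)) $ j \<noteq> 0}"
  have "closed ?C"
    unfolding matrix_vector_mult_def vector_scalar_mult_def
    by (intro closed_Collect_conj closed_Collect_eq continuous_intros)
  moreover have "open ?O" by (intro open_Collect_conj open_Collect_neq continuous_intros)
  ultimately have "fst ` (?C \<inter> ?O) \<in> sets borel" by (rule borel_projection)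
  moreover have "fst ` (?C \<inter> ?O) = {X. multiple_at j X}"
    by (auto simp: multiple_at_def image_iff Bex_def) blast
  ultimately show "{X \<in> unitary_group. multiple_at j X} \<in> sets M"
    using haar_sets[OF haar] by (metis Collect_conj_eq Collect_mem_eq Int_commute)
  define d where "d i a = (if a = j then phase i else 1)" for i a
  define D :: "nat \<Rightarrow> complex^'n^'n" where "D i = (\<chi> a b. if a = b then d i a else 0)" for i
  have Dv: "(D i *v v) $ a = d i a * v $ a" for i a and v :: "complex^'n"
    by (simp add: D_def matrix_vector_mult_def if_distrib if_distribR cong: if_cong)
  have d1: "cnj (d i a) * d i a = 1" for i a by (simp add: d_def cnj_phase)
  show "D i \<in> unitary_group" for i
  proof -
    have "(conj_transpose (D i) *v v) $ a = cnj (d i a) * v $ a" for a and v :: "complex^'n"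
      by (simp add: D_def conj_transpose_def matrix_vector_mult_def if_distrib if_distribR cong: if_cong)
    then have "conj_transpose (D i) *v (D i *v v) = v" "D i *v (conj_transpose (D i) *v v) = v" for v
      using d1[of i] by (simp_all add: vec_eq_iff Dv mult.commute[of "d i _"] flip: mult.assoc)
    then show ?thesis
      by (simp add: unitary_group_def matrix_eq flip: matrix_vector_mul_assoc)
  qed
  fix X :: "complex^'n^'n" assume X: "X \<in> unitary_group"
  define I where "I = {i. D i ** X \<in> {X \<in> unitary_group. multiple_at j X}}"
  have "\<exists>c v. eigenval X c \<and> D i *v (X *v v) = c *s v \<and> v $ j \<noteq> 0" if "i \<in> I" for i
  proof -
    have "multiple_at j (D i ** X)" using that by (simp add: I_def)
    then obtain c u v where "(D i ** X) *v u = c *s u" "(D i ** X) *v v = c *s v"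
      and uv: "u $ j = 0" "u \<noteq> 0" "v $ j \<noteq> 0"
      unfolding multiple_at_def by blast
    then have * : "D i *v (X *v u) = c *s u" "D i *v (X *v v) = c *s v"
      by (simp_all add: matrix_vector_mul_assoc)
    \<comment> \<open>At \<open>j\<close> both sides vanish because \<open>u $ j = 0\<close>; in
      every other coordinate \<open>D i\<close> acts as the identity.\<close>
    have "(X *v u) $ a = c * u $ a" for a
    proof -
      have "d i a * (X *v u) $ a = c * u $ a"
        using arg_cong[OF *(1), of "\<lambda>x. x $ a"] by (simp add: Dv)
      then show ?thesis using uv(1) by (auto simp: d_def split: if_splits)
    qed
    then have "eigenval X c" using uv(2) by (auto simp: eigenval_def vec_eq_iff)
    then show ?thesis using *(2) uv(3) by (intro exI[of _ c] exI[of _ v] conjI)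
  qed
  then have "\<forall>i\<in>I. \<exists>p. eigenval X (fst p) \<and> D i *v (X *v snd p) = fst p *s snd p \<and> snd p $ j \<noteq> 0"
    by simp
  from bchoice[OF this] obtain p where p:
      "\<forall>i\<in>I. eigenval X (fst (p i)) \<and> D i *v (X *v snd (p i)) = fst (p i) *s snd (p i) \<and> snd (p i) $ j \<noteq> 0"
    by blast
  define c v where "c i = fst (p i)" and "v i = snd (p i)" for i
  have c: "eigenval X (c i)" and v: "D i *v (X *v v i) = c i *s v i" "v i $ j \<noteq> 0" if "i \<in> I" for i
    using p that by (simp_all add: c_def v_def)
  have "inj_on c I"
  proof (rule inj_onI)
    fix i k assume i: "i \<in> I" and k: "k \<in> I" and eq: "c i = c k"
    have Xv: "(X *v v l) $ a = cnj (d l a) * c l * v l $ a" if "l \<in> I" for l a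
    proof -
      have "d l a * (X *v v l) $ a = c l * v l $ a"
        using arg_cong[OF v(1)[OF that], of "\<lambda>x. x $ a"] by (simp add: Dv)
      then have "cnj (d l a) * d l a * (X *v v l) $ a = cnj (d l a) * c l * v l $ a"
        by (simp add: mult.assoc)
      then show ?thesis by (simp add: d1)
    qed
    have c1: "cnj (c k) * c k = 1"
      using norm_unitary_eigenval[OF X c[OF k]] by (metis complex_norm_square mult.commute of_real_1 one_power2)
    \<comment> \<open>\<open>X\<close> preserves this inner product. For equal eigenvalues all
      coordinates except \<open>j\<close> contribute the same before and after, so the coordinate
      \<open>j\<close> alone forces the two phases to agree.\<close>
    have "cdot (v i) (v k) = cdot (X *v v i) (X *v v k)"
      by (rule cdot_unitary[OF X, symmetric])
    also have "\<dots> = (\<Sum>a\<in>UNIV. d i a * cnj (d k a) * (cnj (v i $ a) * v k $ a) * (cnj (c k) * c k))"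
      unfolding cdot_def by (intro sum.cong refl) (simp add: Xv i k eq)
    finally have "(\<Sum>a\<in>UNIV. (d i a * cnj (d k a) - 1) * (cnj (v i $ a) * v k $ a)) = 0"
      by (simp add: c1 cdot_def left_diff_distrib sum_subtractf)
    also have "(\<Sum>a\<in>UNIV. (d i a * cnj (d k a) - 1) * (cnj (v i $ a) * v k $ a)) =
        (\<Sum>a\<in>{j}. (d i a * cnj (d k a) - 1) * (cnj (v i $ a) * v k $ a))"
      by (intro sum.mono_neutral_right) (auto simp: d_def)
    finally have "phase i * cnj (phase k) = 1"
      using v(2)[OF i] v(2)[OF k] by (simp add: d_def)
    then have "phase i * (cnj (phase k) * phase k) = phase k" by (simp flip: mult.assoc)
    then have "phase i = phase k" by (simp add: cnj_phase)
    then show "i = k" using inj_phase by (simp add: inj_eq)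
  qed
  moreover have "c ` I \<subseteq> {c. eigenval X c}" using c by auto
  ultimately show "finite {i. D i ** X \<in> {X \<in> unitary_group. multiple_at j X}} \<and>
      card {i. D i ** X \<in> {X \<in> unitary_group. multiple_at j X}} \<le> CARD('n)"
    unfolding I_def[symmetric] using eigenvals_finite_card[OF X] by (meson card_inj_on_le inj_on_finite le_trans)
qed

text \<open>Given two eigenvectors for \<open>c\<close> and a coordinate \<open>j\<close> where
  \<open>v\<close> is nonzero, subtracting the multiple of \<open>v\<close> that cancels coordinate
  \<open>j\<close> of \<open>w\<close> must leave 0, as otherwise \<open>multiple_at j X\<close>
  holds. Only finitely many \<open>j\<close> occur.\<close>

lemma AE_haar_simple:
  fixes M :: "(complex^'n^'n) measure"
  assumes haar: "haar_unitary M"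
  shows "AE X in M. X \<in> unitary_group \<and> \<not> eigenval X 1 \<and>
    (\<forall>c v w. v \<noteq> 0 \<longrightarrow> X *v v = c *s v \<longrightarrow> X *v w = c *s w \<longrightarrow> (\<exists>a. w = a *s v))"
proof -
  have "AE X in M. X \<in> unitary_group"
    using AE_space[of M] by (simp add: haar_space[OF haar])
  moreover have "AE X in M. X \<notin> {X \<in> unitary_group. eigenval X 1}"
    by (rule AE_not_in[OF haar_null_eigenval_1[OF haar]])
  moreover have "AE X in M. \<forall>j. X \<notin> {X \<in> unitary_group. multiple_at j X}"
    using AE_not_in[OF haar_null_multiple_at[OF haar]] by (subst AE_all_countable) simp
  ultimately show ?thesis
  proof eventually_elim
    case (elim X)
    have "\<exists>a. w = a *s v" if v: "v \<noteq> 0" "X *v v = c *s v" and w: "X *v w = c *s w" for c v w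
    proof -
      obtain j where j: "v $ j \<noteq> 0" using v by (auto simp: vec_eq_iff)
      define a where "a = w $ j / v $ j"
      have "X *v (w - a *s v) = c *s (w - a *s v)"
        using v w by (simp add: matrix_vector_mult_diff_distrib vector_scalar_commute vec_eq_iff algebra_simps)
      moreover have "(w - a *s v) $ j = 0" using j by (simp add: a_def)
      moreover have "\<not> multiple_at j X" using elim by simp
        ultimately have "w - a *s v = 0"
        unfolding multiple_at_def using j v(2) by blast
      then show ?thesis by auto
    qed
    with elim show ?case by auto
  qed
qed

section \<open>The logarithm of \<open>\<xi>\<close>\<close>

text \<open>The polynomial has simple roots and degree exactly \<open>CARD('n)\<close>, so it has
  that many roots; its value 1 at 0 normalises the factors to \<open>1 - x / c\<close>.\<close>

lemma xi_eq_prod: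
  fixes U :: "complex^'n^'n"
  assumes U: "U \<in> unitary_group" and one: "\<not> eigenval U 1"
    and simple: "\<And>c v w. v \<noteq> 0 \<Longrightarrow> U *v v = c *s v \<Longrightarrow> U *v w = c *s w \<Longrightarrow> \<exists>a. w = a *s v"
  shows "card {c. eigenval U c} = CARD('n)"
    and "xi U z = (\<Prod>c | eigenval U c. (1 - exp (2 * \<i> * pi * z / of_nat CARD('n)) / c) / (1 - 1 / c))"
proof -
  define E where "E = {c. eigenval U c}"
  obtain p where p: "degree p \<le> CARD('n)" "coeff p CARD('n) = det (- conj_transpose U)"
      "\<And>x. poly p x = det (mat 1 - conj_transpose U ** mat x)"
    using char_poly_exists[of "conj_transpose U"] by blast
  have roots: "{x. poly p x = 0} = E"
    by (simp add: p(3) det_eq_0_iff_eigenval[OF U] E_def)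
  have "rsquarefree p"
    unfolding rsquarefree_roots
  proof (intro allI notI, elim conjE)
    fix c assume "poly p c = 0" and d: "poly (pderiv p) c = 0"
    then obtain v where v: "v \<noteq> 0" "U *v v = c *s v"
      using roots by (auto simp: E_def eigenval_def)
    from simple_eigenspace_imp_simple_root[OF U v simple[OF v] p(3)] d show False by simp
  qed
  then have decomp: "p = smult (lead_coeff p) (\<Prod>c\<in>E. [:- c, 1:])"
    using complex_poly_decompose_rsquarefree[of p] roots by simp
  \<comment> \<open>The top coefficient is the determinant of a matrix with inverse
    \<open>- U\<close>, hence nonzero.\<close>
  have "(- conj_transpose U) ** (- U) = conj_transpose U ** U"
    by (simp add: matrix_matrix_mult_def vec_eq_iff)
  then have "det (- conj_transpose U) * det (- U) = 1"
    using U by (simp add: unitary_group_def flip: det_mul)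
  then have "coeff p CARD('n) \<noteq> 0" using p(2) by auto
  then have deg: "degree p = CARD('n)" using p(1) le_degree by (metis antisym)
  have "degree p = degree (\<Prod>c\<in>E. [:- c, 1:])"
    using \<open>coeff p CARD('n) \<noteq> 0\<close> by (subst decomp) auto
  also have "\<dots> = card E" by (subst degree_prod_eq_sum_degree) auto
  finally show "card {c. eigenval U c} = CARD('n)" using deg by (simp add: E_def)
  have nz: "c \<noteq> 0" if "c \<in> E" for c
    using norm_unitary_eigenval[OF U, of c] that by (auto simp: E_def)
  have factor: "poly p x = (\<Prod>c\<in>E. 1 - x / c)" for x
  proof -
    have eval: "poly p x = lead_coeff p * (\<Prod>c\<in>E. - c) * (\<Prod>c\<in>E. 1 - x / c)" for x
    proof -
      have "poly p x = lead_coeff p * (\<Prod>c\<in>E. x - c)"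
        by (subst decomp) (simp add: poly_prod)
      also have "(\<Prod>c\<in>E. x - c) = (\<Prod>c\<in>E. - c * (1 - x / c))"
        using nz by (intro prod.cong refl) (simp add: field_simps)
      finally show ?thesis by (simp only: prod.distrib mult.assoc)
    qed
    have "poly p 0 = 1" by (simp add: p(3))
    then have "lead_coeff p * (\<Prod>c\<in>E. - c) = 1" using eval[of 0] by simp
    then show ?thesis using eval[of x] by simp
  qed
  have "char_Z U x = (\<Prod>c\<in>E. 1 - x / c)" for x
    using U by (simp add: char_Z_def unitary_matrix_inv p(3) flip: factor)
  then show "xi U z = (\<Prod>c | eigenval U c. (1 - exp (2 * \<i> * pi * z / of_nat CARD('n)) / c) / (1 - 1 / c))"
    by (simp add: xi_def prod_dividef flip: E_def)
qed

section \<open>The logarithm of a single factor\<close>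

definition log_factor :: "real \<Rightarrow> complex \<Rightarrow> complex"
  where "log_factor d w = Ln (1 - exp (2 * \<i> * pi * w / of_real d))"

text \<open>The argument \<open>1 - exp (2 \<pi> \<i> w / d)\<close> meets the branch cut of the principal logarithm exactly
  on the half-lines hanging from \<open>d \<int>\<close>, so the principal branch already has the domain required
  of \<open>log \<xi>\<close>.\<close>
lemma one_minus_exp_nonpos_Reals:
  assumes d: "d > 0" and w: "1 - exp (2 * \<i> * pi * w / of_real d) \<in> \<real>\<^sub>\<le>\<^sub>0"
  shows "\<exists>(m::int) u. u \<ge> 0 \<and> w = of_real (d * m) - \<i> * of_real u"
proof -
  define \<zeta> where "\<zeta> = 2 * \<i> * pi * w / of_real d"
  obtain r where r: "r \<le> 0" "1 - exp \<zeta> = of_real r"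
    using w by (auto simp: nonpos_Reals_def \<zeta>_def)
  then have "exp \<zeta> = of_real (1 - r)"
    by (metis diff_diff_eq2 add_diff_cancel_left' of_real_1 of_real_diff)
  also have "\<dots> = exp (of_real (ln (1 - r)))"
    using r by (subst exp_of_real) simp
  \<comment> \<open>Since \<open>1 - r \<ge> 1\<close>, its logarithm is nonnegative; division by
    \<open>2 * \<i> * pi\<close> turns it into a depth below the real axis.\<close>
  finally obtain m :: int where m: "\<zeta> = of_real (ln (1 - r)) + of_int (2 * m) * pi * \<i>"
    by (auto simp: exp_eq)
  have "w = \<zeta> * of_real d / (2 * \<i> * pi)"
    using d by (simp add: \<zeta>_def)
  also have "\<dots> = of_real (d * m) - \<i> * of_real (ln (1 - r) * d / (2 * pi))"
    unfolding m by (simp add: field_simps)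
  finally show ?thesis
    using r d by (intro exI[of _ m] exI[of _ "ln (1 - r) * d / (2 * pi)"] conjI) simp_all
qed

text \<open>With \<open>s\<close> the fractional part of \<open>t / d\<close>, the argument of the
  logarithm has modulus \<open>2 * sin (pi * s) > 0\<close> and angle
  \<open>pi * s - pi / 2\<close>, which lies in the principal range.\<close>

lemma Im_log_factor:
  assumes d: "d > 0" and t: "t / d \<notin> \<int>"
  shows "Im (log_factor d (of_real t)) = pi * (frac (t / d) - 1 / 2)"
proof -
  define s where "s = frac (t / d)"
  have s: "0 < s" "s < 1" using t frac_gt_0_iff frac_lt_1 by (auto simp: s_def)
  then have sin: "sin (pi * s) > 0" by (intro sin_gt_zero) auto
  have "exp (2 * \<i> * pi * of_real t / of_real d) = exp (\<i> * of_real (2 * pi * s))"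
    unfolding exp_eq
    by (rule exI[of _ "\<lfloor>t / d\<rfloor>"]) (simp add: s_def frac_def field_simps)
  also have "\<dots> = cis (2 * (pi * s))" by (simp add: cis_conv_exp mult_ac)
  finally have e: "exp (2 * \<i> * pi * of_real t / of_real d) = cis (2 * (pi * s))" .
  have "exp (Complex (ln (2 * sin (pi * s))) (pi * s - pi / 2)) = 1 - cis (2 * (pi * s))"
    using sin unfolding exp_eq_polar
    by (simp add: complex_eq_iff cos_diff sin_diff cos_double_sin sin_double power2_eq_square)
  moreover have "- pi < pi * s - pi / 2" "pi * s - pi / 2 \<le> pi"
    using s mult_strict_left_mono[of s 1 pi] mult_pos_pos[of pi s] pi_gt_zero by linarith+
  ultimately have "Ln (1 - cis (2 * (pi * s))) = Complex (ln (2 * sin (pi * s))) (pi * s - pi / 2)"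
    by (intro Ln_unique) auto
  then have "Im (log_factor d (of_real t)) = pi * s - pi / 2"
    unfolding log_factor_def e by simp
  then show ?thesis by (simp add: s_def right_diff_distrib)
qed

section \<open>The slit plane and uniqueness of the logarithm\<close>

lemma upper_half_plane_subset_log_domain: "{z. Im z > 0} \<subseteq> log_domain U"
  by (auto simp: log_domain_def)

lemma log_domain_add_Im:
  assumes "z \<in> log_domain U" "u \<ge> 0"
  shows "z + \<i> * of_real u \<in> log_domain U"
proof (rule ccontr)
  assume "z + \<i> * of_real u \<notin> log_domain U"
  then obtain y u' where y: "y \<in> eig_points U" "u' \<ge> 0" "z + \<i> * of_real u = of_real y - \<i> * of_real u'"
    by (auto simp: log_domain_def)
  then have "z = of_real y - \<i> * of_real (u' + u)"
    by (simp add: algebra_simps eq_diff_eq)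
  moreover have "u' + u \<ge> 0" using y(2) assms(2) by simp
  ultimately show False using y(1) assms(1) unfolding log_domain_def by blast
qed

text \<open>The slits point downwards, so the upward ray from any point of the domain stays inside
  and reaches the upper half-plane. All these rays are glued together by that half-plane.\<close>

lemma connected_log_domain: "connected (log_domain U)"
proof -
  define H where "H = {z. Im z > 0}"
  define R where "R z = (\<lambda>u. z + \<i> * of_real u) ` {0..}" for z
  have "connected (H \<union> R z)" for z
  proof (rule connected_Un)
    show "connected H" unfolding H_def by (intro convex_connected convex_halfspace_Im_gt)
    show "connected (R z)" unfolding R_def
      by (intro connected_continuous_image continuous_intros convex_connected) auto
    have "z + \<i> * of_real (\<bar>Im z\<bar> + 1) \<in> R z" unfolding R_def by (rule imageI) simp
    moreover have "z + \<i> * of_real (\<bar>Im z\<bar> + 1) \<in> H" by (simp add: H_def)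
    ultimately have "z + \<i> * of_real (\<bar>Im z\<bar> + 1) \<in> H \<inter> R z" by blast
    then show "H \<inter> R z \<noteq> {}" by blast
  qed
  moreover have eq: "log_domain U = (\<Union>z\<in>log_domain U. H \<union> R z)"
  proof
    show "log_domain U \<subseteq> (\<Union>z\<in>log_domain U. H \<union> R z)"
      by (auto simp: R_def intro: image_eqI[of _ _ 0])
    show "(\<Union>z\<in>log_domain U. H \<union> R z) \<subseteq> log_domain U"
      using upper_half_plane_subset_log_domain log_domain_add_Im by (fastforce simp: R_def H_def)
  qed
  moreover have "\<i> \<in> (\<Inter>z\<in>log_domain U. H \<union> R z)" by (simp add: H_def)
  then have "(\<Inter>z\<in>log_domain U. H \<union> R z) \<noteq> {}" by blast
  ultimately have "connected (\<Union>z\<in>log_domain U. H \<union> R z)"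
    by (intro connected_Union) auto
  with eq show ?thesis by simp
qed

text \<open>Two continuous logarithms differ by a continuous function with values in
  \<open>2 * pi * \<i>\<close> times the integers; on a connected domain it is constant, and it
  vanishes at 0. Outside the domain the value 0 is the convention of \<open>log_xi\<close>.\<close>

lemma log_xi_eqI:
  assumes cont: "continuous_on (log_domain U) g" and exp: "\<And>z. z \<in> log_domain U \<Longrightarrow> exp (g z) = xi U z"
    and zero: "0 \<in> log_domain U" "g 0 = 0"
  shows "log_xi U z = (if z \<in> log_domain U then g z else 0)"
proof -
  let ?D = "log_domain U"
  have "log_xi U = (\<lambda>z. if z \<in> ?D then g z else 0)"
    unfolding log_xi_def
  proof (rule the_equality)
    have "continuous_on ?D (\<lambda>z. if z \<in> ?D then g z else 0)"
      using cont by (rule continuous_on_eq) simp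
    then show "continuous_on ?D (\<lambda>z. if z \<in> ?D then g z else 0) \<and>
        (\<forall>z\<in>?D. exp (if z \<in> ?D then g z else 0) = xi U z) \<and>
        (if 0 \<in> ?D then g 0 else 0) = 0 \<and> (\<forall>z. z \<notin> ?D \<longrightarrow> (if z \<in> ?D then g z else 0) = 0)"
      using exp zero by simp
  next
    fix h assume h: "continuous_on ?D h \<and> (\<forall>z\<in>?D. exp (h z) = xi U z) \<and> h 0 = 0 \<and> (\<forall>z. z \<notin> ?D \<longrightarrow> h z = 0)"
    have one: "exp (h z - g z) = 1" if "z \<in> ?D" for z
      using that h exp[OF that] by (simp add: exp_diff) (metis div_self exp_not_eq_zero)
    have "(\<lambda>z. h z - g z) constant_on ?D"
    proof (rule continuous_discrete_range_constant[OF connected_log_domain])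
      show "continuous_on ?D (\<lambda>z. h z - g z)" using h cont by (intro continuous_intros) auto
      fix x assume x: "x \<in> ?D"
      have "2 * pi \<le> norm ((h y - g y) - (h x - g x))" if y: "y \<in> ?D" "h y - g y \<noteq> h x - g x" for y
      proof -
        have "exp (h y - g y) = exp (h x - g x)" using one x y by simp
        then obtain m :: int where m: "h y - g y = h x - g x + of_int (2 * m) * pi * \<i>"
          by (auto simp: exp_eq)
        with y have "m \<noteq> 0" by auto
        then have "1 \<le> \<bar>real_of_int m\<bar>" by linarith
        moreover have "norm ((h y - g y) - (h x - g x)) = 2 * \<bar>real_of_int m\<bar> * pi"
          unfolding m by (simp add: norm_mult)
        ultimately show ?thesis by simp
      qed
      then show "\<exists>e>0. \<forall>y. y \<in> ?D \<and> h y - g y \<noteq> h x - g x \<longrightarrow> e \<le> norm ((h y - g y) - (h x - g x))"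
        by (intro exI[of _ "2 * pi"]) auto
    qed
    then obtain k where k: "\<And>z. z \<in> ?D \<Longrightarrow> h z - g z = k" by (auto simp: constant_on_def)
    have "k = 0" using k[OF zero(1)] zero(2) h by simp
    then show "h = (\<lambda>z. if z \<in> ?D then g z else 0)" using k h by auto
  qed
  then show ?thesis by simp
qed

section \<open>Eigenvalue points and the explicit logarithm\<close>

text \<open>For \<open>c\<close> on the unit circle and \<open>n > 0\<close>, the representative in
  [0, n) of the real points with \<open>exp (2 * \<i> * pi * x / n) = c\<close>.\<close>

definition eig_point :: "nat \<Rightarrow> complex \<Rightarrow> real"
  where "eig_point n c = real n / (2 * pi) * Arg2pi c"

lemma exp_eig_point:
  assumes "cmod c = 1" "n > 0"
  shows "exp (2 * \<i> * pi * of_real (eig_point n c + n * of_int m) / of_nat n) = c"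
proof -
  have "exp (2 * \<i> * pi * of_real (eig_point n c + n * of_int m) / of_nat n) = exp (\<i> * of_real (Arg2pi c))"
    unfolding exp_eq using assms(2)
    by (intro exI[of _ m]) (simp add: eig_point_def field_simps)
  then show ?thesis using assms(1) by (simp add: complex_norm_eq_1_exp)
qed

text \<open>Angles of one eigenvalue differ by multiples of \<open>2 * pi\<close>, so after
  rescaling each eigenvalue contributes a progression of step \<open>CARD('n)\<close>.\<close>

lemma eig_points_eq:
  fixes U :: "complex^'n^'n"
  assumes U: "U \<in> unitary_group"
  shows "eig_points U = (\<Union>c\<in>{c. eigenval U c}. range (\<lambda>m::int. eig_point CARD('n) c + CARD('n) * m))"
proof (intro equalityI subsetI)
  fix x assume "x \<in> eig_points U"
  then obtain \<theta> where \<theta>: "x = real CARD('n) / (2 * pi) * \<theta>" "eigenval U (exp (\<i> * of_real \<theta>))"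
    by (auto simp: eig_points_def)
  define c where "c = exp (\<i> * of_real \<theta>)"
  have "exp (\<i> * of_real \<theta>) = exp (\<i> * of_real (Arg2pi c))"
    using complex_norm_eq_1_exp[of c] by (simp add: c_def)
  then obtain m :: int where "\<i> * of_real \<theta> = \<i> * of_real (Arg2pi c) + of_int (2 * m) * pi * \<i>"
    by (auto simp: exp_eq)
  then have "\<i> * of_real \<theta> = \<i> * of_real (Arg2pi c + 2 * m * pi)"
    by (simp add: algebra_simps)
  then have "\<theta> = Arg2pi c + 2 * m * pi"
    by (metis complex_i_not_zero mult_cancel_left of_real_eq_iff)
  then have "x = eig_point CARD('n) c + CARD('n) * m"
    by (simp add: \<theta>(1) eig_point_def field_simps)
  then show "x \<in> (\<Union>c\<in>{c. eigenval U c}. range (\<lambda>m::int. eig_point CARD('n) c + CARD('n) * m))"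
    using \<theta>(2) by (auto simp: c_def)
next
  fix x assume "x \<in> (\<Union>c\<in>{c. eigenval U c}. range (\<lambda>m::int. eig_point CARD('n) c + CARD('n) * m))"
  then obtain c and m :: int where c: "eigenval U c" and x: "x = eig_point CARD('n) c + CARD('n) * m"
    by auto
  define \<theta> where "\<theta> = 2 * pi * x / CARD('n)"
  have "exp (\<i> * of_real \<theta>) = c"
    using exp_eig_point[OF norm_unitary_eigenval[OF U c], of "CARD('n)" m]
    by (simp add: \<theta>_def x mult_ac)
  moreover have "x = real CARD('n) / (2 * pi) * \<theta>" by (simp add: \<theta>_def)
  ultimately show "x \<in> eig_points U" using c by (auto simp: eig_points_def)
qed

text \<open>The cut of each translated \<open>log_factor\<close> consists of slits hanging from the
  points of one eigenvalue, all outside \<open>log_domain U\<close>. The subtracted constants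
  account for the denominators of the product and make the sum vanish at 0.\<close>

lemma log_xi_eq_sum:
  fixes U :: "complex^'n^'n"
  assumes U: "U \<in> unitary_group" and one: "\<not> eigenval U 1"
    and simple: "\<And>c v w. v \<noteq> 0 \<Longrightarrow> U *v v = c *s v \<Longrightarrow> U *v w = c *s w \<Longrightarrow> \<exists>a. w = a *s v"
  shows "log_xi U z = (if z \<in> log_domain U then
    (\<Sum>c | eigenval U c. log_factor CARD('n) (z - of_real (eig_point CARD('n) c))
      - log_factor CARD('n) (- of_real (eig_point CARD('n) c))) else 0)"
proof (rule log_xi_eqI)
  let ?D = "log_domain U" and ?n = "real CARD('n)" and ?a = "eig_point CARD('n)"
  let ?e = "\<lambda>w. exp (2 * \<i> * pi * w / of_real ?n)"
  show zero: "0 \<in> ?D"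
  proof (rule ccontr)
    assume "0 \<notin> ?D"
    then obtain y u where yu: "y \<in> eig_points U" "0 = of_real y - \<i> * of_real u"
      by (auto simp: log_domain_def)
    then have "y = 0" by (simp add: complex_eq_iff)
    with yu(1) one show False by (auto simp: eig_points_def)
  qed
  have cut: "1 - ?e (z - of_real (?a c)) \<notin> \<real>\<^sub>\<le>\<^sub>0" if c: "eigenval U c" and z: "z \<in> ?D" for c z
  proof
    assume "1 - ?e (z - of_real (?a c)) \<in> \<real>\<^sub>\<le>\<^sub>0"
    from one_minus_exp_nonpos_Reals[OF _ this] obtain m :: int and u
      where u: "u \<ge> 0" "z - of_real (?a c) = of_real (?n * m) - \<i> * of_real u" by auto
    then have "z = of_real (?a c + ?n * m) - \<i> * of_real u" by (simp add: algebra_simps)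
    moreover have "?a c + ?n * m \<in> eig_points U" using c by (auto simp: eig_points_eq[OF U])
    ultimately show False using z u(1) by (auto simp: log_domain_def)
  qed
  then show "continuous_on ?D (\<lambda>z. \<Sum>c | eigenval U c. log_factor ?n (z - of_real (?a c)) - log_factor ?n (- of_real (?a c)))"
    unfolding log_factor_def by (intro continuous_intros) auto
  have shift: "?e (z - of_real (?a c)) = ?e z / c" if "eigenval U c" for c z
  proof -
    have "?e (of_real (?a c)) = c"
      using exp_eig_point[OF norm_unitary_eigenval[OF U that], of "CARD('n)" 0] by simp
    then show ?thesis by (simp add: exp_diff right_diff_distrib diff_divide_distrib)
  qed
  have log: "exp (log_factor ?n (z - of_real (?a c))) = 1 - ?e z / c" if "eigenval U c" "z \<in> ?D" for c z
  proof -
    have "1 - ?e (z - of_real (?a c)) \<noteq> 0" using cut[OF that] by auto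
    then show ?thesis using shift[OF that(1), of z] by (simp add: log_factor_def)
  qed
  show "exp (\<Sum>c | eigenval U c. log_factor ?n (z - of_real (?a c)) - log_factor ?n (- of_real (?a c))) = xi U z"
    if "z \<in> ?D" for z
    using log[OF _ that] log[OF _ zero] eigenvals_finite_card[OF U]
    by (simp add: xi_eq_prod[OF U one simple] exp_sum exp_diff)
qed simp

section \<open>The sum over eigenvalue points as an integral against the logarithm\<close>

theorem proposition3p4:
  fixes P :: "'w measure" and U :: "'w \<Rightarrow> complex^'n^'n" and f :: "real \<Rightarrow> real"
  assumes "prob_space P"
    and "U \<in> measurable P borel_unitary"
    and "haar_unitary (distr P borel_unitary U)"
    and "integrable lborel f"
    and "f C1_differentiable_on UNIV"
    and "((\<lambda>x. \<bar>x * f x\<bar>) \<longlongrightarrow> 0) at_infinity"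
    and "(\<integral>\<^sup>+x. ennreal \<bar>x * deriv f x\<bar> \<partial>lborel) < \<infinity>"
  shows "AE \<omega> in P.
    f summable_on eig_points (U \<omega>) \<and>
    integrable lborel (\<lambda>y. Im (log_xi (U \<omega>) (of_real y)) * deriv f y) \<and>
    (\<Sum>\<^sub>\<infinity>x\<in>eig_points (U \<omega>). f x) - (LBINT x. f x) =
      1 / pi * (LBINT y. Im (log_xi (U \<omega>) (of_real y)) * deriv f y)"
proof -
  obtain f' where f': "\<And>x. (f has_real_derivative f' x) (at x)" "continuous_on UNIV f'"
    using assms(5) by (auto simp: C1_differentiable_on_def has_real_derivative_iff_has_vector_derivative)
  have deriv: "deriv f = f'" using f'(1) DERIV_imp_deriv by blast
  have int': "integrable lborel f'"
    using integrable_of_integrable_times[OF f'(2)] assms(7) by (simp add: deriv)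
  note AE_distrD[OF assms(2) AE_haar_simple[OF assms(3)]]
  then show ?thesis
  proof eventually_elim
    case (elim \<omega>)
    define X where "X = U \<omega>"
    have X: "X \<in> unitary_group" and one: "\<not> eigenval X 1"
      and simple: "\<And>c v w. v \<noteq> 0 \<Longrightarrow> X *v v = c *s v \<Longrightarrow> X *v w = c *s w \<Longrightarrow> \<exists>a. w = a *s v"
      using elim by (auto simp: X_def)
    define n where "n = CARD('n)"
    define E where "E = {c. eigenval X c}"
    define a where "a = eig_point n"
    \<comment> \<open>Collects the 1/2 of the principal branch and the normalisation at 0, so that
      each summand of the imaginary part becomes \<open>pi\<close> times a sawtooth shifted by
      \<open>\<kappa> c\<close>.\<close>
    define \<kappa> where "\<kappa> c = 1 / 2 + Im (log_factor n (- of_real (a c))) / pi" for c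
    have n: "n > 0" by (simp add: n_def)
    have E: "finite E" "card E = n"
      using eigenvals_finite_card(1)[OF X] xi_eq_prod(1)[OF X one simple] by (simp_all add: E_def n_def)
    have points: "eig_points X = (\<Union>c\<in>E. range (\<lambda>m::int. a c + n * m))"
      using eig_points_eq[OF X] by (simp add: E_def a_def n_def)
    \<comment> \<open>A common point determines the eigenvalue through the exponential.\<close>
    have "c = c'" if c: "c \<in> E" "c' \<in> E" "range (\<lambda>m::int. a c + n * m) \<inter> range (\<lambda>m::int. a c' + n * m) \<noteq> {}"
      for c c'
    proof -
      obtain m m' :: int where "a c + n * m = a c' + n * m'" using c(3) by auto
      then show ?thesis
        using exp_eig_point[of c n m] exp_eig_point[of c' n m'] norm_unitary_eigenval[OF X] c n
        by (simp add: E_def a_def)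
    qed
    then have disjoint: "range (\<lambda>m::int. a c + n * m) \<inter> range (\<lambda>m::int. a c' + n * m) = {}"
      if "c \<in> E" "c' \<in> E" "c \<noteq> c'" for c c'
      using that by blast
    define saw where "saw c = (\<lambda>y. (frac ((y - a c) / n) - \<kappa> c) * f' y)" for c
    have lattice: "(f has_sum ((LBINT x. f x) / n + (LBINT y. saw c y))) (range (\<lambda>m::int. a c + n * m))"
      and int_saw: "integrable lborel (saw c)" for c
    proof -
      have "inj (\<lambda>m::int. a c + n * m)" using n by (auto simp: inj_def)
      then show "(f has_sum ((LBINT x. f x) / n + (LBINT y. saw c y))) (range (\<lambda>m::int. a c + n * m))"
        using has_sum_lattice(1)[OF _ f' assms(4) int', of "real n" "a c" "\<kappa> c"] n
        by (subst has_sum_reindex) (auto simp: o_def saw_def)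
      show "integrable lborel (saw c)"
        unfolding saw_def using has_sum_lattice(2)[OF _ f' assms(4) int', of "real n" "a c" "\<kappa> c"] n by simp
    qed
    \<comment> \<open>There are exactly \<open>n\<close> eigenvalues, so the terms with the integral
      of \<open>f\<close> divided by \<open>n\<close> add up to one full integral.\<close>
    have sum: "(f has_sum ((LBINT x. f x) + (\<Sum>c\<in>E. LBINT y. saw c y))) (eig_points X)"
      using sum_has_sum[OF E(1) lattice disjoint] E n by (simp add: points sum.distrib)
    have "countable (eig_points X)"
      unfolding points using E(1) by (intro countable_UN countable_image) (auto intro: countable_finite)
    then have [measurable]: "eig_points X \<in> sets borel" by (rule sets.countable[rotated]) auto
    \<comment> \<open>The indicator reflects the value 0 of \<open>log_xi\<close> on the slits. It
      also yields measurability, and it is 1 almost everywhere because the points are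
      countable.\<close>
    have log: "Im (log_xi X (of_real y)) * f' y = indicator (- eig_points X) y *\<^sub>R (pi * (\<Sum>c\<in>E. saw c y))" for y
    proof (cases "y \<in> eig_points X")
      case True
      then have "of_real y \<notin> log_domain X"
        by (fastforce simp: log_domain_def intro: exI[of _ "0 :: real"])
      then show ?thesis using True by (simp add: log_xi_eq_sum[OF X one simple])
    next
      case False
      have "of_real y \<in> log_domain X"
      proof (rule ccontr)
        assume "of_real y \<notin> log_domain X"
        then obtain y' u where "y' \<in> eig_points X" "of_real y = of_real y' - \<i> * of_real u"
          by (auto simp: log_domain_def)
        with False show False by (simp add: complex_eq_iff)
      qed
      moreover have "Im (log_factor n (of_real y - of_real (a c))) = pi * (frac ((y - a c) / n) - 1 / 2)" if "c \<in> E" for c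
      proof -
        have "(y - a c) / n \<notin> \<int>"
        proof
          assume "(y - a c) / n \<in> \<int>"
          then obtain m :: int where "(y - a c) / n = m" by (auto elim: Ints_cases)
          then have "y = a c + n * m" using n by (simp add: field_simps)
          with False that points show False by auto
        qed
        then show ?thesis using Im_log_factor[of n "y - a c"] n by simp
      qed
      ultimately have "Im (log_xi X (of_real y)) = (\<Sum>c\<in>E. pi * (frac ((y - a c) / n) - 1 / 2)
          - Im (log_factor n (- of_real (a c))))"
        by (simp add: log_xi_eq_sum[OF X one simple] flip: E_def n_def a_def)
      also have "\<dots> = (\<Sum>c\<in>E. pi * (frac ((y - a c) / n) - \<kappa> c))"
        by (intro sum.cong refl) (simp add: \<kappa>_def field_simps)
      finally show ?thesis
        using False by (simp add: saw_def sum_distrib_left sum_distrib_right mult.assoc)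
    qed
    have int_sum: "integrable lborel (\<lambda>y. pi * (\<Sum>c\<in>E. saw c y))"
      using int_saw by (intro integrable_mult_right Bochner_Integration.integrable_sum) auto
    have int_log: "integrable lborel (\<lambda>y. Im (log_xi X (of_real y)) * f' y)"
      unfolding log using int_sum by (intro integrable_mult_indicator) auto
    have "(LBINT y. Im (log_xi X (of_real y)) * f' y) = (LBINT y. pi * (\<Sum>c\<in>E. saw c y))"
    proof (rule integral_cong_AE)
      have "AE y in lborel. y \<notin> eig_points X"
        by (intro AE_not_in countable_imp_null_set_lborel) fact
      then show "AE y in lborel. Im (log_xi X (of_real y)) * f' y = pi * (\<Sum>c\<in>E. saw c y)"
        unfolding log by eventually_elim simp
    qed (use int_log int_sum in auto)
    also have "\<dots> = pi * (\<Sum>c\<in>E. LBINT y. saw c y)"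
      using int_saw by (simp add: Bochner_Integration.integral_sum)
    finally have "1 / pi * (LBINT y. Im (log_xi X (of_real y)) * f' y) = (\<Sum>c\<in>E. LBINT y. saw c y)"
      by simp
    then show ?case
      using sum int_log by (auto simp: deriv has_sum_imp_summable infsumI simp flip: X_def)
  qed
qed

end
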